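(* Let $\mathbb{S}_1$, $\mathbb{S}_2$, and $\mathbb{S}_3$ be metric spaces, let $\mathcal{A}$ be a set of real-valued continuous functions on $\mathbb{S}_1\times\mathbb{S}_2$ which is equicontinuous and uniformly bounded, and let a stochastic kernel $\Psi(ds_2|s_3)$ on $\mathbb{S}_2$ given $\mathbb{S}_3$ be weakly continuous. If $\mathbb{S}_2$ is separable, then the set of functions $$\mathcal{A}^\Psi:=\left\{(s_1,s_3)\mapsto\int_{\mathbb{S}_2}f(s_1,s_2)\,\Psi(ds_2|s_3)\,:\, f\in\mathcal{A}\right\}$$ on $\mathbb{S}_1\times\mathbb{S}_3$ is equicontinuous and uniformly bounded by the same constant as the set $\mathcal{A}$.
   Context: Products of metric spaces carry the product topology. $\mathcal{B}(\mathbb{S})$ denotes the Borel $\sigma$-field of a metric space $\mathbb{S}$. A set $\mathtt{F}$ of real-valued functions on a metric space $\mathbb{S}$ is equicontinuous at $s\in\mathbb{S}$ if $\lim_{s'\to s}\sup_{f\in\mathtt{F}}|f(s')-f(s)|=0$; it is equicontinuous (on $\mathbb{S}$) if this holds at every $s\in\mathbb{S}$ (this is pointwise, not uniform, equicontinuity). It is uniformly bounded (by a constant $M<+\infty$) if $|f(s)|\le M$ for all $s\in\mathbb{S}$ and all $f\in\mathtt{F}$. A stochastic kernel $\Psi(ds_2|s_3)$ on $\mathbb{S}_2$ given $\mathbb{S}_3$ is a mapping $\Psi:\mathcal{B}(\mathbb{S}_2)\times\mathbb{S}_3\to[0,1]$ such that $\Psi(\,\cdot\,|s_3)$ is a probability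 measure on $\mathbb{S}_2$ for every $s_3\in\mathbb{S}_3$, and $\Psi(B|\,\cdot\,)$ is Borel-measurable on $\mathbb{S}_3$ for every $B\in\mathcal{B}(\mathbb{S}_2)$. It is weakly continuous if $\Psi(\,\cdot\,|s_3^{(n)})$ converges weakly to $\Psi(\,\cdot\,|s_3)$ (i.e., integrals of every bounded continuous function on $\mathbb{S}_2$ converge) whenever $s_3^{(n)}\to s_3$ in $\mathbb{S}_3$. *)

theory Defs
  imports "HOL-Probability.Probability"
begin

text \<open>
  The supremum is formed in \<^typ>\<open>ennreal\<close>, because it may be infinite away from \<open>s\<close>;
  moreover the empty supremum in \<^typ>\<open>ennreal\<close> is 0, so that the empty family is equicontinuous.
\<close>

definition equicontinuous_at :: "('a::metric_space \<Rightarrow> real) set \<Rightarrow> 'a \<Rightarrow> bool" where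
  "equicontinuous_at F s \<longleftrightarrow>
     ((\<lambda>s'. SUP f\<in>F. ennreal \<bar>f s' - f s\<bar>) \<longlongrightarrow> 0) (at s)"

definition equicontinuous :: "('a::metric_space \<Rightarrow> real) set \<Rightarrow> bool" where
  "equicontinuous F \<longleftrightarrow> (\<forall>s. equicontinuous_at F s)"

definition uniformly_bounded_by :: "('a \<Rightarrow> real) set \<Rightarrow> real \<Rightarrow> bool" where
  "uniformly_bounded_by F M \<longleftrightarrow> (\<forall>f\<in>F. \<forall>s. \<bar>f s\<bar> \<le> M)"

text \<open>
  A kernel \<open>\<Psi>(ds\<^sub>2|s\<^sub>3)\<close> is represented by the map sending \<open>s\<^sub>3\<close> to the measure \<open>\<Psi>(\<cdot>|s\<^sub>3)\<close>.
\<close>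

definition stochastic_kernel :: "('c::metric_space \<Rightarrow> 'b::metric_space measure) \<Rightarrow> bool" where
  "stochastic_kernel \<Psi> \<longleftrightarrow>
     (\<forall>s. prob_space (\<Psi> s) \<and> sets (\<Psi> s) = sets borel) \<and>
     (\<forall>B\<in>sets borel. (\<lambda>s. measure (\<Psi> s) B) \<in> borel_measurable borel)"

lemma stochastic_kernel_iff_prob_algebra:
  "stochastic_kernel \<Psi> \<longleftrightarrow> \<Psi> \<in> borel \<rightarrow>\<^sub>M prob_algebra borel"
proof
  assume k: "stochastic_kernel \<Psi>"
  have "(\<lambda>s. emeasure (\<Psi> s) B) \<in> borel_measurable borel" if "B \<in> sets borel" for B
  proof -
    have "(\<lambda>s. emeasure (\<Psi> s) B) = (\<lambda>s. ennreal (measure (\<Psi> s) B))"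
      using k by (auto simp: stochastic_kernel_def finite_measure.emeasure_eq_measure
          prob_space.finite_measure)
    then show ?thesis
      using k that by (auto simp: stochastic_kernel_def)
  qed
  then show "\<Psi> \<in> borel \<rightarrow>\<^sub>M prob_algebra borel"
    using k
    by (auto simp: stochastic_kernel_def prob_space_imp_subprob_space prob_algebra_def
        intro!: measurable_restrict_space2 measurable_subprob_algebra)
next
  assume k: "\<Psi> \<in> borel \<rightarrow>\<^sub>M prob_algebra borel"
  then have "\<Psi> s \<in> space (prob_algebra borel)" for s
    by (rule measurable_space) simp
  moreover have "(\<lambda>s. measure (\<Psi> s) B) \<in> borel_measurable borel" if "B \<in> sets borel" for B
    using measurable_compose[OF measurable_prob_algebraD[OF k] measurable_measure_subprob_algebra]
      that by blast
  ultimately show "stochastic_kernel \<Psi>"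
    by (auto simp: stochastic_kernel_def space_prob_algebra)
qed

text \<open>
  The library's \<^const>\<open>weak_conv_m\<close> is the convergence of distribution functions of measures on
  the real line; on a general metric space weak convergence has to be tested on bounded
  continuous functions.
\<close>

definition weakly_converges :: "(nat \<Rightarrow> 'b::metric_space measure) \<Rightarrow> 'b measure \<Rightarrow> bool" where
  "weakly_converges \<mu> \<nu> \<longleftrightarrow>
     (\<forall>g::'b \<Rightarrow> real. continuous_on UNIV g \<longrightarrow> bounded (range g) \<longrightarrow>
        (\<lambda>n. \<integral>x. g x \<partial>\<mu> n) \<longlonglongrightarrow> (\<integral>x. g x \<partial>\<nu>))"

definition weakly_continuous_kernel ::
    "('c::metric_space \<Rightarrow> 'b::metric_space measure) \<Rightarrow> bool" where
  "weakly_continuous_kernel \<Psi> \<longleftrightarrow>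
     (\<forall>t s. t \<longlonglongrightarrow> s \<longrightarrow> weakly_converges (\<lambda>n. \<Psi> (t n)) (\<Psi> s))"

definition kernel_integrals ::
    "('a \<times> 'b \<Rightarrow> real) set \<Rightarrow> ('c \<Rightarrow> 'b measure) \<Rightarrow> ('a \<times> 'c \<Rightarrow> real) set" where
  "kernel_integrals \<A> \<Psi> = {\<lambda>(s\<^sub>1, s\<^sub>3). \<integral>s\<^sub>2. f (s\<^sub>1, s\<^sub>2) \<partial>\<Psi> s\<^sub>3 | f. f \<in> \<A>}"

end

theory Submission
  imports Defs
begin

text \<open>
  Near a fixed point \<open>(x, z)\<close>, equicontinuity and the Lindeloef property of \<open>S\<^sub>2\<close> provide countably
  many balls on each of which all \<open>f \<in> \<A>\<close> are almost constant, uniformly for first arguments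
  near \<open>x\<close>. Finitely many of them carry almost all of \<open>\<Psi>(\<cdot>|z)\<close>, and continuous weights \<open>w\<^sub>i\<close>
  subordinate to them replace \<open>\<integral> f(x', y) \<Psi>(dy|z')\<close> by \<open>\<Sum>\<^sub>i f(x, b\<^sub>i) \<integral> w\<^sub>i d\<Psi>(\<cdot>|z')\<close>, uniformly in
  \<open>f\<close>. Only the finitely many integrals \<open>\<integral> w\<^sub>i d\<Psi>(\<cdot>|z')\<close> depend on \<open>z'\<close>, and these converge as \<open>z' \<rightarrow> z\<close>
  by weak continuity.
\<close>

section \<open>Equicontinuity by neighbourhoods\<close>

text \<open>At \<open>s\<close> itself all differences vanish, so the punctured filter may be
  replaced by \<open>nhds s\<close>, which splits as a product filter on product spaces. The
  inequality is non-strict because only such a bound survives the supremum.\<close>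

lemma equicontinuous_at_iff_eventually:
  fixes F :: "('a::metric_space \<Rightarrow> real) set"
  shows "equicontinuous_at F s \<longleftrightarrow>
    (\<forall>e>0. \<forall>\<^sub>F s' in nhds s. \<forall>f\<in>F. \<bar>f s' - f s\<bar> \<le> e)" (is "?L \<longleftrightarrow> ?R")
proof
  assume L: ?L
  show ?R
  proof (intro allI impI)
    fix e :: real assume "e > 0"
    then have "\<forall>\<^sub>F s' in at s. (SUP f\<in>F. ennreal \<bar>f s' - f s\<bar>) < ennreal e"
      using L by (auto simp: equicontinuous_at_def intro: order_tendstoD(2))
    then have "\<forall>\<^sub>F s' in at s. \<forall>f\<in>F. \<bar>f s' - f s\<bar> \<le> e"
    proof eventually_elim
      case (elim s')
      show ?case
      proof
        fix f assume "f \<in> F"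
        then have "ennreal \<bar>f s' - f s\<bar> < ennreal e"
          by (rule le_less_trans[OF SUP_upper elim])
        then show "\<bar>f s' - f s\<bar> \<le> e"
          by (simp add: ennreal_less_iff)
      qed
    qed
    then show "\<forall>\<^sub>F s' in nhds s. \<forall>f\<in>F. \<bar>f s' - f s\<bar> \<le> e"
      using \<open>e > 0\<close> by (simp add: eventually_nhds_conv_at)
  qed
next
  assume R: ?R
  show ?L
    unfolding equicontinuous_at_def
  proof (rule order_tendstoI)
    fix a :: ennreal assume "0 < a"
    \<comment> \<open>An intermediate \<open>c\<close> is finite even if \<open>a = top\<close>, and
      the gap below \<open>a\<close> turns the non-strict bound on the supremum into a strict
      one.\<close>
    then obtain c where c: "0 < c" "c < a"
      using dense by blast
    define e where "e = enn2real c"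
    have "c < top"
      using c(2) top_greatest by (rule less_le_trans)
    then have e: "c = ennreal e" "e > 0"
      using c(1) by (simp_all add: e_def enn2real_positive_iff)
    have "\<forall>\<^sub>F s' in at s. \<forall>f\<in>F. \<bar>f s' - f s\<bar> \<le> e"
      using R \<open>e > 0\<close> by (simp add: eventually_nhds_conv_at)
    then show "\<forall>\<^sub>F s' in at s. (SUP f\<in>F. ennreal \<bar>f s' - f s\<bar>) < a"
    proof eventually_elim
      case (elim s')
      then have "(SUP f\<in>F. ennreal \<bar>f s' - f s\<bar>) \<le> ennreal e"
        by (intro SUP_least ennreal_leI) auto
      then show ?case
        using c e by simp
    qed
  qed simp
qed

section \<open>Countable covers and subordinate weights\<close>

text \<open>Balls centred at a dense sequence need not cover, since \<open>r\<close> may be very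
  small there. Instead, for each dense point \<open>c\<close> and each scale \<open>k\<close>, one
  centre near \<open>c\<close> is chosen whose radius is large compared with that scale.\<close>

lemma separable_countable_ball_cover:
  fixes r :: "'b::metric_space \<Rightarrow> real"
  assumes sep: "separable_space (euclidean :: 'b topology)" and r: "\<And>y. r y > 0"
  obtains I where "countable I" "(\<Union>y\<in>I. ball y (r y)) = UNIV"
proof -
  obtain C :: "'b set" where C: "countable C" "closure C = UNIV"
    using sep by (auto simp: separable_space_def)
  define P where "P = (\<lambda>(c, k) y. dist c y < 1 / real (Suc k) \<and> 2 / real (Suc k) \<le> r y)"
  \<comment> \<open>If no \<open>y\<close> satisfies \<open>P q\<close>, the choice adds an
    arbitrary centre, which is harmless.\<close>
  define I where "I = (\<lambda>q. SOME y. P q y) ` (C \<times> (UNIV :: nat set))"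
  have "\<exists>y'\<in>I. y \<in> ball y' (r y')" for y
  proof -
    obtain k where k: "inverse (real (Suc k)) < r y / 2"
      using reals_Archimedean[of "r y / 2"] r[of y] by auto
    obtain c where c: "c \<in> C" "dist c y < 1 / real (Suc k)"
      using C(2) closure_approachable[of y C] by (auto dest: spec[of _ "1 / real (Suc k)"])
    define y' where "y' = (SOME y. P (c, k) y)"
    \<comment> \<open>The point \<open>y\<close> qualifies for \<open>(c, k)\<close>, so the chosen
      \<open>y'\<close> does too. Both lie within \<open>1 / real (Suc k)\<close> of
      \<open>c\<close>, and the radius at \<open>y'\<close> is at least twice that.\<close>
    have "P (c, k) y"
      using k c by (simp add: P_def field_simps)
    then have "P (c, k) y'"
      unfolding y'_def by (rule someI)
    then have "dist y' y < r y'"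
      using dist_triangle3[of y' y c] c(2) by (auto simp: P_def)
    moreover have "y' \<in> I"
      using c(1) by (auto simp: I_def y'_def)
    ultimately show ?thesis
      by auto
  qed
  moreover have "countable I"
    using C(1) by (simp add: I_def)
  ultimately show thesis
    by (intro that[of I]) blast+
qed

text \<open>Normalised tent functions on the first \<open>n\<close> balls have sums tending to 1
  pointwise, because the balls cover; dominated convergence then leaves mass less than
  \<open>\<eta>\<close> uncovered for some finite \<open>N\<close>.\<close>

lemma exists_subordinate_weights:
  fixes b :: "nat \<Rightarrow> 'b::metric_space" and r :: "nat \<Rightarrow> real"
  assumes P: "prob_space P" "sets P = sets borel"
    and cover: "(\<Union>i. ball (b i) (r i)) = UNIV" and "\<eta> > 0"
  obtains N :: nat and w :: "nat \<Rightarrow> 'b \<Rightarrow> real" where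
    "\<And>i. continuous_on UNIV (w i)" "\<And>i y. 0 \<le> w i y"
    "\<And>i y. w i y \<noteq> 0 \<Longrightarrow> y \<in> ball (b i) (r i)"
    "\<And>y. (\<Sum>i<N. w i y) \<le> 1" "(\<integral>y. (\<Sum>i<N. w i y) \<partial>P) > 1 - \<eta>"
proof -
  interpret prob_space P by fact
  define \<phi> where "\<phi> = (\<lambda>i y. max 0 (r i - dist (b i) y))"
  define S where "S = (\<lambda>n y. \<Sum>i<n. \<phi> i y)"
  \<comment> \<open>The extra \<open>1 / real (Suc n)\<close> keeps the quotient continuous where
    \<open>S n\<close> vanishes, and disappears in the limit.\<close>
  define w where "w = (\<lambda>n i y. \<phi> i y / (1 / real (Suc n) + S n y))"
  have \<phi>_nonneg: "0 \<le> \<phi> i y" for i y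
    by (simp add: \<phi>_def)
  have S_nonneg: "0 \<le> S n y" for n y
    by (simp add: S_def \<phi>_nonneg sum_nonneg)
  have den_pos: "0 < 1 / real (Suc n) + S n y" for n y
    by (rule add_pos_nonneg) (simp_all add: S_nonneg)
  have w_nonneg: "0 \<le> w n i y" for n i y
    using den_pos[of n y] \<phi>_nonneg[of i y] by (simp add: w_def)
  have w_cont: "continuous_on UNIV (w n i)" for n i
  proof -
    have \<phi>_cont: "continuous_on UNIV (\<phi> j)" for j
      unfolding \<phi>_def by (intro continuous_intros)
    then have "continuous_on UNIV (S n)"
      unfolding S_def by (intro continuous_intros)
    then show ?thesis
      unfolding w_def using den_pos[of n]
      by (intro continuous_intros \<phi>_cont) (auto simp: less_imp_neq[symmetric])
  qed
  have w_sum: "(\<Sum>i<n. w n i y) = S n y / (1 / real (Suc n) + S n y)" for n y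
    by (simp add: w_def S_def sum_divide_distrib)
  have w_sum_le: "(\<Sum>i<n. w n i y) \<le> 1" for n y
    unfolding w_sum using den_pos[of n y] by (simp add: divide_le_eq_1)
  have w_lim: "(\<lambda>n. \<Sum>i<n. w n i y) \<longlonglongrightarrow> 1" for y
  proof -
    obtain i where "y \<in> ball (b i) (r i)"
      using cover by blast
    then have pos: "\<phi> i y > 0"
      by (simp add: \<phi>_def)
    \<comment> \<open>One ball around \<open>y\<close> gives a lower bound on \<open>S n y\<close>
      that does not depend on \<open>n\<close>.\<close>
    have ge: "S n y \<ge> \<phi> i y" if "n > i" for n
      unfolding S_def using that \<phi>_nonneg by (intro member_le_sum) auto
    have "(\<lambda>n. 1 - inverse (real (Suc n)) / \<phi> i y) \<longlonglongrightarrow> 1 - 0 / \<phi> i y"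
      using pos by (intro tendsto_intros LIMSEQ_inverse_real_of_nat) auto
    then have lim: "(\<lambda>n. 1 - inverse (real (Suc n)) / \<phi> i y) \<longlonglongrightarrow> 1"
      by simp
    show ?thesis
    proof (rule tendsto_sandwich[OF _ _ lim tendsto_const])
      show "\<forall>\<^sub>F n in sequentially. 1 - inverse (real (Suc n)) / \<phi> i y \<le> (\<Sum>i<n. w n i y)"
        using eventually_gt_at_top[of i]
      proof eventually_elim
        case (elim n)
        define u where "u = 1 / real (Suc n)"
        have u: "u > 0" by (simp add: u_def)
        have "1 - (\<Sum>i<n. w n i y) = u / (u + S n y)"
          using den_pos[of n y] unfolding w_sum u_def[symmetric] by (simp add: field_simps)
        also have "\<dots> \<le> u / \<phi> i y"
          using ge[OF elim] pos u by (intro divide_left_mono) auto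
        finally show ?case
          by (simp add: u_def inverse_eq_divide)
      qed
    qed (simp add: w_sum_le)
  qed
  have "(\<lambda>n. \<integral>y. (\<Sum>i<n. w n i y) \<partial>P) \<longlonglongrightarrow> (\<integral>y. 1 \<partial>P)"
  proof (rule integral_dominated_convergence[where w = "\<lambda>_. 1"])
    show "(\<lambda>y. \<Sum>i<n. w n i y) \<in> borel_measurable P" for n
      unfolding measurable_cong_sets[OF P(2) refl]
      by (intro borel_measurable_sum borel_measurable_continuous_onI w_cont)
    show "AE y in P. norm (\<Sum>i<n. w n i y) \<le> 1" for n
      using w_sum_le by (simp add: sum_nonneg w_nonneg)
  qed (use w_lim in auto)
  then have "\<forall>\<^sub>F n in sequentially. (\<integral>y. (\<Sum>i<n. w n i y) \<partial>P) > 1 - \<eta>"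
    using \<open>\<eta> > 0\<close> by (intro order_tendstoD(1)[where y = "\<integral>y. 1 \<partial>P"]) (auto simp: prob_space)
  then obtain N where N: "(\<integral>y. (\<Sum>i<N. w N i y) \<partial>P) > 1 - \<eta>"
    by (auto simp: eventually_sequentially)
  have "y \<in> ball (b i) (r i)" if "w N i y \<noteq> 0" for i y
    using that by (auto simp: w_def \<phi>_def max_def split: if_splits)
  then show thesis
    using that w_cont w_nonneg w_sum_le N by blast
qed

section \<open>Approximation of integrals and weak limits\<close>

text \<open>The error splits into the oscillation of \<open>g\<close> on the supports of the
  weights, at most \<open>\<eta>\<close>, and the part of \<open>g\<close> that the weights miss, at
  most \<open>M\<close> times the missing mass. The bound involves \<open>g\<close> only through
  \<open>M\<close> and \<open>\<eta>\<close>, hence is uniform over a family.\<close>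

lemma integral_weighted_sum_approx:
  fixes g :: "'b \<Rightarrow> real" and w :: "'i \<Rightarrow> 'b \<Rightarrow> real"
  assumes "prob_space P" and "finite J"
    and g: "g \<in> borel_measurable P" "\<And>y. \<bar>g y\<bar> \<le> M"
    and w: "\<And>i. i \<in> J \<Longrightarrow> w i \<in> borel_measurable P" "\<And>i y. 0 \<le> w i y"
      "\<And>y. (\<Sum>i\<in>J. w i y) \<le> 1"
    and c: "\<And>i y. i \<in> J \<Longrightarrow> w i y \<noteq> 0 \<Longrightarrow> \<bar>g y - c i\<bar> \<le> \<eta>" and "0 \<le> \<eta>"
  shows "\<bar>(\<integral>y. g y \<partial>P) - (\<Sum>i\<in>J. c i * (\<integral>y. w i y \<partial>P))\<bar>
           \<le> \<eta> + M * (1 - (\<Sum>i\<in>J. \<integral>y. w i y \<partial>P))"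
proof -
  interpret prob_space P by fact
  have M: "0 \<le> M"
    using g(2) by (rule order_trans[OF abs_ge_zero])
  have w_le: "w i y \<le> 1" if "i \<in> J" for i y
    using member_le_sum[of i J "\<lambda>i. w i y"] that w(2) w(3)[of y] \<open>finite J\<close> by fastforce
  have w_int: "integrable P (w i)" if "i \<in> J" for i
    using that w w_le by (intro integrable_const_bound[where B = 1]) auto
  have g_int: "integrable P g"
    using g by (intro integrable_const_bound[where B = M]) auto
  have cw_int: "integrable P (\<lambda>y. \<Sum>i\<in>J. c i * w i y)"
    using w_int by auto
  have W_int: "integrable P (\<lambda>y. \<Sum>i\<in>J. w i y)"
    using w_int by auto
  have bound: "\<bar>g y - (\<Sum>i\<in>J. c i * w i y)\<bar> \<le> \<eta> + M * (1 - (\<Sum>i\<in>J. w i y))" for y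
  proof -
    have "g y - (\<Sum>i\<in>J. c i * w i y)
        = (\<Sum>i\<in>J. (g y - c i) * w i y) + g y * (1 - (\<Sum>i\<in>J. w i y))"
      by (simp add: algebra_simps sum_subtractf sum_distrib_left)
    moreover have "\<bar>\<Sum>i\<in>J. (g y - c i) * w i y\<bar> \<le> \<eta>"
    proof -
      have "\<bar>\<Sum>i\<in>J. (g y - c i) * w i y\<bar> \<le> (\<Sum>i\<in>J. \<bar>(g y - c i) * w i y\<bar>)"
        by (rule sum_abs)
      also have "\<dots> \<le> (\<Sum>i\<in>J. \<eta> * w i y)"
      proof (rule sum_mono)
        fix i assume "i \<in> J"
        then show "\<bar>(g y - c i) * w i y\<bar> \<le> \<eta> * w i y"
          using c[of i y] w(2)[of i y]
          by (cases "w i y = 0") (auto simp: abs_mult intro: mult_right_mono)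
      qed
      also have "\<dots> \<le> \<eta> * 1"
        unfolding sum_distrib_left[symmetric] using w(3) \<open>0 \<le> \<eta>\<close> by (intro mult_left_mono)
      finally show ?thesis by simp
    qed
    moreover have "\<bar>g y * (1 - (\<Sum>i\<in>J. w i y))\<bar> \<le> M * (1 - (\<Sum>i\<in>J. w i y))"
      using g(2)[of y] w(3)[of y] by (auto simp: abs_mult intro: mult_right_mono)
    ultimately show ?thesis by linarith
  qed
  have "(\<integral>y. g y \<partial>P) - (\<Sum>i\<in>J. c i * (\<integral>y. w i y \<partial>P))
      = (\<integral>y. g y - (\<Sum>i\<in>J. c i * w i y) \<partial>P)"
    using w_int by (simp add: Bochner_Integration.integral_diff[OF g_int cw_int])
  also have "\<bar>\<dots>\<bar> \<le> (\<integral>y. \<bar>g y - (\<Sum>i\<in>J. c i * w i y)\<bar> \<partial>P)"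
    by (rule integral_abs_bound)
  also have "\<dots> \<le> (\<integral>y. \<eta> + M * (1 - (\<Sum>i\<in>J. w i y)) \<partial>P)"
    using g_int cw_int W_int bound by (intro integral_mono) auto
  also have "\<dots> = \<eta> + M * (1 - (\<Sum>i\<in>J. \<integral>y. w i y \<partial>P))"
    using w_int W_int by (simp add: prob_space)
  finally show ?thesis .
qed

text \<open>Metric spaces are first countable, so convergence along sequences yields a limit along
  \<open>nhds z\<close>, which can be combined with a filter in the other variable.\<close>

lemma weakly_continuous_kernel_tendsto:
  fixes g :: "'b::metric_space \<Rightarrow> real"
  assumes "weakly_continuous_kernel \<Psi>" "continuous_on UNIV g" "bounded (range g)"
  shows "((\<lambda>z'. \<integral>y. g y \<partial>\<Psi> z') \<longlongrightarrow> (\<integral>y. g y \<partial>\<Psi> z)) (nhds z)"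
proof -
  have "isCont (\<lambda>z'. \<integral>y. g y \<partial>\<Psi> z') z"
  proof (rule continuous_at_sequentiallyI)
    fix u assume "u \<longlonglongrightarrow> z"
    then have "weakly_converges (\<lambda>n. \<Psi> (u n)) (\<Psi> z)"
      using assms(1) unfolding weakly_continuous_kernel_def by blast
    then show "(\<lambda>n. \<integral>y. g y \<partial>\<Psi> (u n)) \<longlonglongrightarrow> (\<integral>y. g y \<partial>\<Psi> z)"
      using assms(2,3) unfolding weakly_converges_def by blast
  qed
  then show ?thesis
    unfolding isCont_def by (rule tendsto_at_iff_tendsto_nhds[THEN iffD1])
qed

section \<open>Equicontinuity of the kernel integrals\<close>

lemma equicontinuous_at_kernel_integrals:
  fixes \<A> :: "('a::metric_space \<times> 'b::metric_space \<Rightarrow> real) set"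
    and \<Psi> :: "'c::metric_space \<Rightarrow> 'b measure"
  assumes cont: "\<And>f. f \<in> \<A> \<Longrightarrow> continuous_on UNIV f"
    and equi: "equicontinuous \<A>"
    and bdd: "uniformly_bounded_by \<A> M"
    and kernel: "stochastic_kernel \<Psi>"
    and weak: "weakly_continuous_kernel \<Psi>"
    and sep: "separable_space (euclidean :: 'b topology)"
    and M: "0 \<le> M"
  shows "equicontinuous_at (kernel_integrals \<A> \<Psi>) (x, z)"
  unfolding equicontinuous_at_iff_eventually
proof (intro allI impI)
  fix e :: real assume "e > 0"
  \<comment> \<open>The final error consists of \<open>\<eta> + 2 * M * \<eta>\<close> at the moving
    point, \<open>\<eta> + M * \<eta>\<close> at \<open>(x, z)\<close> and \<open>M * \<eta>\<close>
    between the two sums. Adding 1 to \<open>M\<close> covers \<open>M = 0\<close>.\<close>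
  define \<eta> where "\<eta> = e / (4 * (M + 1))"
  have \<eta>: "\<eta> > 0" "2 * \<eta> + 4 * M * \<eta> \<le> e"
  proof -
    show "\<eta> > 0"
      using M \<open>e > 0\<close> by (simp add: \<eta>_def)
    have "4 * (M + 1) * \<eta> = e"
      using M by (simp add: \<eta>_def)
    then have "4 * M * \<eta> + 4 * \<eta> = e"
      by (simp only: distrib_left distrib_right mult_1_right)
    then show "2 * \<eta> + 4 * M * \<eta> \<le> e"
      using \<open>\<eta> > 0\<close> by linarith
  qed
  have P: "prob_space (\<Psi> z')" "sets (\<Psi> z') = sets borel" for z'
    using kernel by (auto simp: stochastic_kernel_def)
  define good where "good y r \<longleftrightarrow> 0 < r \<and> (\<forall>x' y'. dist x' x < r \<longrightarrow> dist y' y < r \<longrightarrow>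
      (\<forall>f\<in>\<A>. \<bar>f (x', y') - f (x, y)\<bar> \<le> \<eta>))" for y r
  have "\<exists>r. good y r" for y
  proof -
    have "\<forall>\<^sub>F p in nhds x \<times>\<^sub>F nhds y. \<forall>f\<in>\<A>. \<bar>f p - f (x, y)\<bar> \<le> \<eta>"
      using equi \<eta>(1) by (simp add: equicontinuous_def equicontinuous_at_iff_eventually nhds_prod)
    then obtain Q R where "eventually Q (nhds x)" "eventually R (nhds y)"
      and QR: "\<And>x' y'. Q x' \<Longrightarrow> R y' \<Longrightarrow> \<forall>f\<in>\<A>. \<bar>f (x', y') - f (x, y)\<bar> \<le> \<eta>"
      by (auto simp: eventually_prod_filter)
    then obtain d1 d2 where d: "d1 > 0" "\<forall>x'. dist x' x < d1 \<longrightarrow> Q x'"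
      "d2 > 0" "\<forall>y'. dist y' y < d2 \<longrightarrow> R y'"
      unfolding eventually_nhds_metric by blast
    show ?thesis
      unfolding good_def
    proof (intro exI[of _ "min d1 d2"] conjI allI impI)
      show "0 < min d1 d2"
        using d by simp
      fix x' y' assume "dist x' x < min d1 d2" "dist y' y < min d1 d2"
      then show "\<forall>f\<in>\<A>. \<bar>f (x', y') - f (x, y)\<bar> \<le> \<eta>"
        using d by (intro QR) simp_all
    qed
  qed
  then obtain r where "\<And>y. good y (r y)"
    by metis
  then have r: "\<And>y. r y > 0"
    and close: "\<And>y x' y' f. \<lbrakk>dist x' x < r y; dist y' y < r y; f \<in> \<A>\<rbrakk>
      \<Longrightarrow> \<bar>f (x', y') - f (x, y)\<bar> \<le> \<eta>"
    by (simp_all add: good_def)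
  obtain I where I: "countable I" "(\<Union>y\<in>I. ball y (r y)) = UNIV"
    by (rule separable_countable_ball_cover[OF sep r])
  \<comment> \<open>The cover makes \<open>I\<close> nonempty; repetitions in the enumeration of a
    finite \<open>I\<close> do no harm.\<close>
  define b where "b = from_nat_into I"
  have "range b = I"
    using I by (auto simp: b_def intro!: range_from_nat_into)
  then have cover: "(\<Union>i. ball (b i) (r (b i))) = UNIV"
    using I(2) by blast
  \<comment> \<open>The weights are adapted to the single measure \<open>\<Psi> z\<close>; weak
    continuity carries their mass over to nearby \<open>z'\<close>.\<close>
  obtain N :: nat and w :: "nat \<Rightarrow> 'b \<Rightarrow> real" where w_cont: "\<And>i. continuous_on UNIV (w i)"
    and w_nonneg: "\<And>i y. 0 \<le> w i y"
    and w_supp: "\<And>i y. w i y \<noteq> 0 \<Longrightarrow> y \<in> ball (b i) (r (b i))"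
    and w_sum: "\<And>y. (\<Sum>i<N. w i y) \<le> 1"
    and w_mass: "(\<integral>y. (\<Sum>i<N. w i y) \<partial>\<Psi> z) > 1 - \<eta>"
    by (rule exists_subordinate_weights[OF P[of z] cover \<eta>(1)], rule that)
  define v where "v = (\<lambda>i z'. \<integral>y. w i y \<partial>\<Psi> z')"
  have w_meas: "w i \<in> borel_measurable (\<Psi> z')" for i z'
    unfolding measurable_cong_sets[OF P(2) refl]
    by (rule borel_measurable_continuous_onI[OF w_cont])
  have w_le: "w i y \<le> 1" if "i < N" for i y
    using member_le_sum[of i "{..<N}" "\<lambda>i. w i y"] that w_nonneg w_sum[of y] by fastforce
  have w_int: "integrable (\<Psi> z') (w i)" if "i < N" for i z'
    using that w_nonneg w_le w_meas P(1)[of z']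
    by (intro finite_measure.integrable_const_bound[where B = 1])
      (auto intro: prob_space.finite_measure)
  have mass: "(\<Sum>i<N. v i z) > 1 - \<eta>"
    using w_mass w_int by (simp add: v_def)
  have v_lim: "(v i \<longlongrightarrow> v i z) (nhds z)" if "i < N" for i
    unfolding v_def using that w_nonneg w_le
    by (intro weakly_continuous_kernel_tendsto weak w_cont boundedI[where B = 1]) auto
  have diff_lim: "((\<lambda>z'. \<Sum>i<N. \<bar>v i z' - v i z\<bar>) \<longlongrightarrow> (\<Sum>i<N. \<bar>v i z - v i z\<bar>)) (nhds z)"
    using v_lim by (intro tendsto_intros) auto
  have near_z: "\<forall>\<^sub>F z' in nhds z. (\<Sum>i<N. \<bar>v i z' - v i z\<bar>) < \<eta>"
    using order_tendstoD(2)[OF diff_lim] \<eta>(1) by simp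
  \<comment> \<open>The radii of the whole cover may have infimum 0; the cut at \<open>N\<close>
    leaves finitely many conditions on \<open>x'\<close>.\<close>
  have near_x: "\<forall>\<^sub>F x' in nhds x. \<forall>i<N. dist x' x < r (b i)"
  proof -
    have "\<forall>\<^sub>F x' in nhds x. dist x' x < r (b i)" for i
      using r by (auto simp: eventually_nhds_metric)
    then show ?thesis
      using eventually_ball_finite[of "{..<N}" "\<lambda>x' i. dist x' x < r (b i)" "nhds x"]
      by (simp add: Ball_def)
  qed
  \<comment> \<open>The coefficients are frozen at \<open>x\<close>, so the sums at two points
    differ only through \<open>v\<close>.\<close>
  have approx: "\<bar>(\<integral>y. f (x', y) \<partial>\<Psi> z') - (\<Sum>i<N. f (x, b i) * v i z')\<bar>
      \<le> \<eta> + M * (1 - (\<Sum>i<N. v i z'))"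
    if "f \<in> \<A>" and x': "\<forall>i<N. dist x' x < r (b i)" for f x' z'
    unfolding v_def
  proof (rule integral_weighted_sum_approx[OF P(1)])
    have "continuous_on UNIV (\<lambda>y. f (x', y))"
      using cont[OF \<open>f \<in> \<A>\<close>]
      by (rule continuous_on_compose2) (auto intro!: continuous_intros)
    then show "(\<lambda>y. f (x', y)) \<in> borel_measurable (\<Psi> z')"
      unfolding measurable_cong_sets[OF P(2) refl] by (rule borel_measurable_continuous_onI)
    show "\<bar>f (x', y)\<bar> \<le> M" for y
      using bdd \<open>f \<in> \<A>\<close> by (auto simp: uniformly_bounded_by_def)
    show "\<bar>f (x', y) - f (x, b i)\<bar> \<le> \<eta>" if "i \<in> {..<N}" "w i y \<noteq> 0" for i y
      using that x' \<open>f \<in> \<A>\<close> w_supp[of i y] by (intro close) (auto simp: dist_commute)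
  qed (use w_meas w_nonneg w_sum \<eta>(1) in auto)
  have "\<forall>\<^sub>F p in nhds x \<times>\<^sub>F nhds z.
      (\<forall>i<N. dist (fst p) x < r (b i)) \<and> (\<Sum>i<N. \<bar>v i (snd p) - v i z\<bar>) < \<eta>"
    by (rule eventually_prodI[OF near_x near_z])
  then have "\<forall>\<^sub>F p in nhds x \<times>\<^sub>F nhds z. \<forall>f\<in>\<A>.
      \<bar>(\<integral>y. f (fst p, y) \<partial>\<Psi> (snd p)) - (\<integral>y. f (x, y) \<partial>\<Psi> z)\<bar> \<le> e"
  proof eventually_elim
    case (elim p)
    show ?case
    proof
      fix f assume f: "f \<in> \<A>"
      let ?A = "\<Sum>i<N. f (x, b i) * v i (snd p)"
      let ?B = "\<Sum>i<N. f (x, b i) * v i z"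
      \<comment> \<open>One \<open>\<eta>\<close> is the mass missed at \<open>z\<close>, the other
        the change from \<open>z\<close> to \<open>snd p\<close>.\<close>
      have mass': "(\<Sum>i<N. v i (snd p)) > 1 - 2 * \<eta>"
      proof -
        have "\<bar>(\<Sum>i<N. v i (snd p)) - (\<Sum>i<N. v i z)\<bar> \<le> (\<Sum>i<N. \<bar>v i (snd p) - v i z\<bar>)"
          unfolding sum_subtractf[symmetric] by (rule sum_abs)
        then show ?thesis
          using elim mass by linarith
      qed
      have "\<bar>?A - ?B\<bar> \<le> (\<Sum>i<N. \<bar>f (x, b i) * v i (snd p) - f (x, b i) * v i z\<bar>)"
        unfolding sum_subtractf[symmetric] by (rule sum_abs)
      also have "\<dots> \<le> (\<Sum>i<N. M * \<bar>v i (snd p) - v i z\<bar>)"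
        using bdd f
        by (intro sum_mono)
          (auto simp: uniformly_bounded_by_def abs_mult simp flip: right_diff_distrib
            intro: mult_right_mono)
      also have "\<dots> \<le> M * \<eta>"
        unfolding sum_distrib_left[symmetric] using elim M by (intro mult_left_mono) auto
      finally have AB: "\<bar>?A - ?B\<bar> \<le> M * \<eta>" .
      have "\<bar>(\<integral>y. f (fst p, y) \<partial>\<Psi> (snd p)) - ?A\<bar> \<le> \<eta> + M * (1 - (\<Sum>i<N. v i (snd p)))"
        using elim by (intro approx f) auto
      also have "\<dots> \<le> \<eta> + M * (2 * \<eta>)"
        using mass' M by (intro add_left_mono mult_left_mono) auto
      finally have A: "\<bar>(\<integral>y. f (fst p, y) \<partial>\<Psi> (snd p)) - ?A\<bar> \<le> \<eta> + M * (2 * \<eta>)" .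
      have "\<bar>(\<integral>y. f (x, y) \<partial>\<Psi> z) - ?B\<bar> \<le> \<eta> + M * (1 - (\<Sum>i<N. v i z))"
        using r by (intro approx f) auto
      also have "\<dots> \<le> \<eta> + M * \<eta>"
        using mass M by (intro add_left_mono mult_left_mono) auto
      finally have "\<bar>(\<integral>y. f (x, y) \<partial>\<Psi> z) - ?B\<bar> \<le> \<eta> + M * \<eta>" .
      with A AB \<eta>(2)
      show "\<bar>(\<integral>y. f (fst p, y) \<partial>\<Psi> (snd p)) - (\<integral>y. f (x, y) \<partial>\<Psi> z)\<bar> \<le> e"
        by (simp add: algebra_simps)
    qed
  qed
  then show "\<forall>\<^sub>F p in nhds (x, z). \<forall>f\<in>kernel_integrals \<A> \<Psi>. \<bar>f p - f (x, z)\<bar> \<le> e"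
    unfolding nhds_prod
    by (rule eventually_mono) (auto simp: kernel_integrals_def case_prod_beta)
qed

section \<open>The uniform bound and the conclusion\<close>

lemma uniformly_bounded_by_kernel_integrals:
  assumes "stochastic_kernel \<Psi>" "uniformly_bounded_by \<A> M"
  shows "uniformly_bounded_by (kernel_integrals \<A> \<Psi>) M"
proof -
  have "\<bar>\<integral>y. f (x, y) \<partial>\<Psi> z\<bar> \<le> M" if "f \<in> \<A>" for f x z
  proof -
    interpret prob_space "\<Psi> z"
      using assms(1) by (simp add: stochastic_kernel_def)
    have bd: "\<bar>f (x, y)\<bar> \<le> M" for y
      using assms(2) that by (simp add: uniformly_bounded_by_def)
    have "\<bar>\<integral>y. f (x, y) \<partial>\<Psi> z\<bar> \<le> (\<integral>y. \<bar>f (x, y)\<bar> \<partial>\<Psi> z)"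
      by (rule integral_abs_bound)
    \<comment> \<open>A non-integrable function has Bochner integral 0, so
      \<open>integral_mono'\<close> asks for integrability of the constant alone, together with
      \<open>0 \<le> M\<close>, which \<open>bd\<close> yields at any point.\<close>
    also have "\<dots> \<le> (\<integral>y. M \<partial>\<Psi> z)"
      using bd order_trans[OF abs_ge_zero bd] by (intro integral_mono') auto
    finally show ?thesis
      by (simp add: prob_space)
  qed
  then show ?thesis
    by (auto simp: uniformly_bounded_by_def kernel_integrals_def)
qed

theorem corollary1:
  fixes \<A> :: "('a::metric_space \<times> 'b::metric_space \<Rightarrow> real) set"
    and \<Psi> :: "'c::metric_space \<Rightarrow> 'b measure"
    and M :: real
  assumes "\<And>f. f \<in> \<A> \<Longrightarrow> continuous_on UNIV f"
    and "equicontinuous \<A>"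
    and "uniformly_bounded_by \<A> M"
    and "stochastic_kernel \<Psi>"
    and "weakly_continuous_kernel \<Psi>"
    and "separable_space (euclidean :: 'b topology)"
  shows "equicontinuous (kernel_integrals \<A> \<Psi>) \<and>
         uniformly_bounded_by (kernel_integrals \<A> \<Psi>) M"
proof
  \<comment> \<open>For empty \<open>\<A>\<close> the constant \<open>M\<close> may be negative,
    whereas the error estimates multiply by it.\<close>
  have "uniformly_bounded_by \<A> \<bar>M\<bar>"
    using assms(3) unfolding uniformly_bounded_by_def by (meson abs_ge_self order_trans)
  then show "equicontinuous (kernel_integrals \<A> \<Psi>)"
    using equicontinuous_at_kernel_integrals[OF assms(1,2) _ assms(4-6) abs_ge_zero]
    by (auto simp: equicontinuous_def)
  show "uniformly_bounded_by (kernel_integrals \<A> \<Psi>) M"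
    using assms(4,3) by (rule uniformly_bounded_by_kernel_integrals)
qed

end
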